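(* Let $q=\langle H,f,f^-,c,c^-\rangle$ be a consistent $q$-dialectical system with connectives, and let $\alpha$ be a good approximation to $H$ such that $(q,\alpha)$ is loopless. Then $A_q^\alpha$ is a dialectical completion, i.e. there is a dialectical system $d$ with connectives such that $A_d=A_q^\alpha$ and $A_d$ is a completion.
   Context: An enumeration operator is a c.e. set $H$ of (codes of) pairs $\langle x,D\rangle$, $x\in\omega$, $D\subseteq\omega$ finite; $H(X)=\{x:\exists D\subseteq X\ \langle x,D\rangle\in H\}$. $H$ is an algebraic closure operator if $X\subseteq H(X)$ and $H(H(X))\subseteq H(X)$ for all $X$. A computable approximation $\alpha=\{H_s\}$ to $H$ is a computable increasing sequence of finite sets of pairs with union $H$; $H_s(X)$ is defined as for $H$. It is good if for every $s$: $X\subseteq H_s(X)$ whenever $\max X\le s$, and $H_s(H_s(X))\subseteq H_s(X)$ for all $X$. A dialectical system is $d=\langle H,f,c\rangle$ with $H$ an enumeration operator that is an algebraic closure operator, $H(\emptyset)\ne\emptyset$, $H(\{c\})=\omega$; $f$ a computable permutation of $\omega$ ($f_i=f(i)$); $c\in\omega$. A $q$-dialectical system is $q=\langle H,f,f^-,c,c^-\rangle$ with $\langle H,f,c\rangle$ a dialectical system, $f^-$ computable and acyclic (every $f^-$-orbit infinite), $c^-\in\omega\setminus\mathrm{range}(f^-)$; it is consistent if $\{c,c^-\}\cap H(\emptyset)=\emptyset$. Procedures relative to $\alpha$: stacks $r_s(x)$, $m(s)$, finite sets $A_s$; $\rho_s(x)$ = top of $r_s(x)$ when nonempty, $L_s(x)=\{\rho_s(y):y<x,\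 r_s(y)\ne\langle\,\rangle\}$, $\chi_s(i)=H_s(L_s(i+1))$. Stage 0: $m(0)=0$, $r_0(0)=\langle f_0\rangle$, others empty, $A_0=\emptyset$. "Extend": $m(s+1)=m+1$, stacks at $x\le m$ unchanged, $r_{s+1}(m+1)=\langle f_{m+1}\rangle$, above empty. "Discard at $z$": if $c\in H_s(\emptyset)$ then $m(s+1)=0$, $r_{s+1}(0)=\langle f_0\rangle$, others empty; otherwise $m(s+1)=z+1$, stacks at $x<z$ unchanged, $r_{s+1}(z+1)=\langle f_{z+1}\rangle$, $r_{s+1}(x)=\langle\,\rangle$ for $x=z$ and $x>z+1$. "Revise at $z$": $m(s+1)=z$, stacks at $x<z$ unchanged, $r_{s+1}(z)=r_s(z)^\frown\langle f^-(\rho_s(z))\rangle$, stacks at $x>z$ empty. Dialectical stage $s+1$ ($m=m(s)$): if no $k\le m$ has $c\in\chi_s(k)$ extend, else discard at the least such $k$. $q$-dialectical stage $s+1$: if no $k\le m$ has $\{c,c^-\}\cap\chi_s(k)\ne\emptyset$ extend; if some $k\le m$ has $c\in\chi_s(k)$ and $c^-\notin\chi_s(k')$ for all $k'<k$, discard at the least such $k$; if some $k\le m$ has $c^-\in\chi_s(k)$ and $c\notin\chi_s(k')$ for all $k'\le k$, revise at the least such $k$. $A_{s+1}=\bigcup_{i<m(s+1)}\chi_{s+1}(i)$. Final theses $\{f_x:\exists t\,\forall s\ge t\ f_x\in A_s\}$: $A_d$ for $d$ (independent of $\alpha$), $A_q^\alpha$ for $q$. $(q,\alpha)$ is loopless if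 for every $u$ the set $\{\rho_s(u):s\in\omega\}$ is finite. A system has connectives if there are injective computable $\neg,\to,\wedge,\vee$ on $\omega$ with, for all $X$, $x,y$: (1) $c\in H(\{x,\neg x\})$; (2) $H(\{\neg\neg x\})=H(\{x\})$; (3) $x\vee\neg x\in H(\emptyset)$; (4) $H(X\cup\{x\vee y\})=H(X\cup\{x\})\cap H(X\cup\{y\})$; (5) if $c\in H(X\cup\{x\})$ then $\neg x\in H(X)$; (6) $x\in H(X\cup\{y\})$ iff $y\to x\in H(X)$. A set $A$ is a completion if for every $x$, $A\cap\{x,\neg x\}$ has exactly one element. *)

theory Defs
  imports Main "HOL-Library.Nat_Bijection"
begin

section \<open>Computability\<close>

datatype recf =
    Zero
  | Succ
  | Proj nat
  | Comp recf "recf list"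
  | PrimRec recf recf
  | Minim recf

text \<open>\<open>computes p xs y\<close>: the partial recursive function described by \<open>p\<close> converges on the
  argument tuple \<open>xs\<close> with value \<open>y\<close>. Recursion and minimization act on the first argument.
  Unbounded search diverges if an earlier value of the searched function diverges.\<close>

inductive computes :: "recf \<Rightarrow> nat list \<Rightarrow> nat \<Rightarrow> bool" where
  Zero: "computes Zero xs 0"
| Succ: "computes Succ [x] (Suc x)"
| Proj: "i < length xs \<Longrightarrow> computes (Proj i) xs (xs ! i)"
| Comp: "length ys = length gs \<Longrightarrow> (\<forall>i<length gs. computes (gs ! i) xs (ys ! i)) \<Longrightarrow>
    computes g ys z \<Longrightarrow> computes (Comp g gs) xs z"
| PrimRec_0: "computes g xs y \<Longrightarrow> computes (PrimRec g h) (0 # xs) y"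
| PrimRec_Suc: "computes (PrimRec g h) (n # xs) y \<Longrightarrow> computes h (n # y # xs) z \<Longrightarrow>
    computes (PrimRec g h) (Suc n # xs) z"
| Minim: "computes g (n # xs) 0 \<Longrightarrow> (\<forall>i<n. \<exists>y. computes g (i # xs) (Suc y)) \<Longrightarrow>
    computes (Minim g) xs n"

definition computable1 :: "(nat \<Rightarrow> nat) \<Rightarrow> bool" where
  "computable1 g \<longleftrightarrow> (\<exists>p. \<forall>x. computes p [x] (g x))"

definition computable2 :: "(nat \<Rightarrow> nat \<Rightarrow> nat) \<Rightarrow> bool" where
  "computable2 g \<longleftrightarrow> (\<exists>p. \<forall>x y. computes p [x, y] (g x y))"

definition comp_enumerable :: "nat set \<Rightarrow> bool" where
  "comp_enumerable A \<longleftrightarrow> (\<exists>p. \<forall>x. x \<in> A \<longleftrightarrow> (\<exists>y. computes p [x] y))"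


section \<open>Enumeration operators and their approximations\<close>

text \<open>An operator is given by the set of codes \<open>prod_encode (x, set_encode D)\<close> of its pairs
  (with \<open>D\<close> finite); both codings are bijective, so every natural number is such a code.\<close>

definition app :: "nat set \<Rightarrow> nat set \<Rightarrow> nat set" where
  "app H X = {x. \<exists>D. finite D \<and> D \<subseteq> X \<and> prod_encode (x, set_encode D) \<in> H}"

definition enumeration_operator :: "nat set \<Rightarrow> bool" where
  "enumeration_operator H \<longleftrightarrow> comp_enumerable H"

definition closure_operator :: "nat set \<Rightarrow> bool" where
  "closure_operator H \<longleftrightarrow> (\<forall>X. X \<subseteq> app H X \<and> app H (app H X) \<subseteq> app H X)"

text \<open>Computability of the sequence of finite sets means computability of their canonical indices.\<close>

definition computable_approximation :: "(nat \<Rightarrow> nat set) \<Rightarrow> nat set \<Rightarrow> bool" where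
  "computable_approximation \<alpha> H \<longleftrightarrow>
     (\<forall>s. finite (\<alpha> s)) \<and> computable1 (\<lambda>s. set_encode (\<alpha> s)) \<and>
     (\<forall>s. \<alpha> s \<subseteq> \<alpha> (Suc s)) \<and> (\<Union>s. \<alpha> s) = H"

definition good_approximation :: "(nat \<Rightarrow> nat set) \<Rightarrow> nat set \<Rightarrow> bool" where
  "good_approximation \<alpha> H \<longleftrightarrow> computable_approximation \<alpha> H \<and>
     (\<forall>s. (\<forall>X. (\<forall>x\<in>X. x \<le> s) \<longrightarrow> X \<subseteq> app (\<alpha> s) X) \<and>
          (\<forall>X. app (\<alpha> s) (app (\<alpha> s) X) \<subseteq> app (\<alpha> s) X))"


section \<open>Dialectical and q-dialectical systems\<close>

definition dialectical_system :: "nat set \<Rightarrow> (nat \<Rightarrow> nat) \<Rightarrow> nat \<Rightarrow> bool" where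
  "dialectical_system H f c \<longleftrightarrow>
     enumeration_operator H \<and> closure_operator H \<and> app H {} \<noteq> {} \<and> app H {c} = UNIV \<and>
     computable1 f \<and> bij f"

definition acyclic_fun :: "(nat \<Rightarrow> nat) \<Rightarrow> bool" where
  "acyclic_fun g \<longleftrightarrow> (\<forall>x. infinite (range (\<lambda>n. (g ^^ n) x)))"

definition q_dialectical_system ::
    "nat set \<Rightarrow> (nat \<Rightarrow> nat) \<Rightarrow> (nat \<Rightarrow> nat) \<Rightarrow> nat \<Rightarrow> nat \<Rightarrow> bool" where
  "q_dialectical_system H f fm c cm \<longleftrightarrow>
     dialectical_system H f c \<and> computable1 fm \<and> acyclic_fun fm \<and> cm \<notin> range fm"

definition q_consistent :: "nat set \<Rightarrow> nat \<Rightarrow> nat \<Rightarrow> bool" where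
  "q_consistent H c cm \<longleftrightarrow> {c, cm} \<inter> app H {} = {}"


section \<open>The procedures\<close>

text \<open>A state consists of the number \<open>m(s)\<close> and the stacks \<open>r\<^sub>s\<close>; the top of a stack is its
  last element. Below, \<open>Hs\<close> is the current finite part of the operator.\<close>

type_synonym state = "nat \<times> (nat \<Rightarrow> nat list)"

definition tops :: "(nat \<Rightarrow> nat list) \<Rightarrow> nat \<Rightarrow> nat set" where
  "tops r x = {last (r y) | y. y < x \<and> r y \<noteq> []}"

definition chi :: "nat set \<Rightarrow> (nat \<Rightarrow> nat list) \<Rightarrow> nat \<Rightarrow> nat set" where
  "chi Hs r i = app Hs (tops r (i + 1))"

definition initial :: "(nat \<Rightarrow> nat) \<Rightarrow> state" where
  "initial f = (0, \<lambda>x. if x = 0 then [f 0] else [])"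

fun extend :: "(nat \<Rightarrow> nat) \<Rightarrow> state \<Rightarrow> state" where
  "extend f (m, r) =
     (m + 1, \<lambda>x. if x \<le> m then r x else if x = m + 1 then [f (m + 1)] else [])"

fun discard :: "nat set \<Rightarrow> (nat \<Rightarrow> nat) \<Rightarrow> nat \<Rightarrow> nat \<Rightarrow> state \<Rightarrow> state" where
  "discard Hs f c z (m, r) =
     (if c \<in> app Hs {} then initial f
      else (z + 1, \<lambda>x. if x < z then r x else if x = z + 1 then [f (z + 1)] else []))"

fun revise :: "(nat \<Rightarrow> nat) \<Rightarrow> nat \<Rightarrow> state \<Rightarrow> state" where
  "revise fm z (m, r) =
     (z, \<lambda>x. if x < z then r x else if x = z then r z @ [fm (last (r z))] else [])"

fun d_step :: "nat set \<Rightarrow> (nat \<Rightarrow> nat) \<Rightarrow> nat \<Rightarrow> state \<Rightarrow> state" where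
  "d_step Hs f c (m, r) =
     (if \<not> (\<exists>k\<le>m. c \<in> chi Hs r k) then extend f (m, r)
      else discard Hs f c (LEAST k. k \<le> m \<and> c \<in> chi Hs r k) (m, r))"

text \<open>The three cases are exhaustive and mutually exclusive, so the condition for revising need
  not be tested again in the last branch.\<close>

fun q_step :: "nat set \<Rightarrow> (nat \<Rightarrow> nat) \<Rightarrow> (nat \<Rightarrow> nat) \<Rightarrow> nat \<Rightarrow> nat \<Rightarrow> state \<Rightarrow> state" where
  "q_step Hs f fm c cm (m, r) =
     (if \<not> (\<exists>k\<le>m. {c, cm} \<inter> chi Hs r k \<noteq> {}) then extend f (m, r)
      else if \<exists>k\<le>m. c \<in> chi Hs r k \<and> (\<forall>k'<k. cm \<notin> chi Hs r k') then
        discard Hs f c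
          (LEAST k. k \<le> m \<and> c \<in> chi Hs r k \<and> (\<forall>k'<k. cm \<notin> chi Hs r k')) (m, r)
      else
        revise fm
          (LEAST k. k \<le> m \<and> cm \<in> chi Hs r k \<and> (\<forall>k'\<le>k. c \<notin> chi Hs r k')) (m, r))"

primrec d_state :: "(nat \<Rightarrow> nat set) \<Rightarrow> (nat \<Rightarrow> nat) \<Rightarrow> nat \<Rightarrow> nat \<Rightarrow> state" where
  "d_state \<alpha> f c 0 = initial f"
| "d_state \<alpha> f c (Suc s) = d_step (\<alpha> s) f c (d_state \<alpha> f c s)"

primrec q_state ::
    "(nat \<Rightarrow> nat set) \<Rightarrow> (nat \<Rightarrow> nat) \<Rightarrow> (nat \<Rightarrow> nat) \<Rightarrow> nat \<Rightarrow> nat \<Rightarrow> nat \<Rightarrow> state" where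
  "q_state \<alpha> f fm c cm 0 = initial f"
| "q_state \<alpha> f fm c cm (Suc s) = q_step (\<alpha> s) f fm c cm (q_state \<alpha> f fm c cm s)"

text \<open>The provisional theses \<open>A\<^sub>s\<close> of a run; as every run starts with \<open>m(0) = 0\<close>, the formula
  also gives \<open>A\<^sub>0 = {}\<close>.\<close>

definition prov_theses :: "(nat \<Rightarrow> nat set) \<Rightarrow> (nat \<Rightarrow> state) \<Rightarrow> nat \<Rightarrow> nat set" where
  "prov_theses \<alpha> run s = (\<Union>i<fst (run s). chi (\<alpha> s) (snd (run s)) i)"

definition final_theses ::
    "(nat \<Rightarrow> nat set) \<Rightarrow> (nat \<Rightarrow> nat) \<Rightarrow> (nat \<Rightarrow> state) \<Rightarrow> nat set" where
  "final_theses \<alpha> f run = {f x | x. \<exists>t. \<forall>s\<ge>t. f x \<in> prov_theses \<alpha> run s}"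

definition d_theses :: "(nat \<Rightarrow> nat set) \<Rightarrow> (nat \<Rightarrow> nat) \<Rightarrow> nat \<Rightarrow> nat set" where
  "d_theses \<alpha> f c = final_theses \<alpha> f (d_state \<alpha> f c)"

definition q_theses ::
    "(nat \<Rightarrow> nat set) \<Rightarrow> (nat \<Rightarrow> nat) \<Rightarrow> (nat \<Rightarrow> nat) \<Rightarrow> nat \<Rightarrow> nat \<Rightarrow> nat set" where
  "q_theses \<alpha> f fm c cm = final_theses \<alpha> f (q_state \<alpha> f fm c cm)"

text \<open>\<open>represents H f c A\<close> says that \<open>A\<close> is the set \<open>A\<^sub>d\<close> of final theses of
  \<open>d = \<langle>H, f, c\<rangle>\<close>. That set does not depend on the approximation, so all approximations are
  required to yield \<open>A\<close>; the first conjunct excludes vacuous truth.\<close>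

definition represents :: "nat set \<Rightarrow> (nat \<Rightarrow> nat) \<Rightarrow> nat \<Rightarrow> nat set \<Rightarrow> bool" where
  "represents H f c A \<longleftrightarrow>
     (\<exists>\<beta>. computable_approximation \<beta> H) \<and>
     (\<forall>\<beta>. computable_approximation \<beta> H \<longrightarrow> d_theses \<beta> f c = A)"

definition loopless ::
    "(nat \<Rightarrow> nat set) \<Rightarrow> (nat \<Rightarrow> nat) \<Rightarrow> (nat \<Rightarrow> nat) \<Rightarrow> nat \<Rightarrow> nat \<Rightarrow> bool" where
  "loopless \<alpha> f fm c cm \<longleftrightarrow>
     (\<forall>u. finite {last (snd (q_state \<alpha> f fm c cm s) u) | s.
            snd (q_state \<alpha> f fm c cm s) u \<noteq> []})"


section \<open>Connectives\<close>

definition connectives ::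
    "nat set \<Rightarrow> nat \<Rightarrow> (nat \<Rightarrow> nat) \<Rightarrow> (nat \<Rightarrow> nat \<Rightarrow> nat) \<Rightarrow> (nat \<Rightarrow> nat \<Rightarrow> nat) \<Rightarrow>
     (nat \<Rightarrow> nat \<Rightarrow> nat) \<Rightarrow> bool" where
  "connectives H c neg imp con dis \<longleftrightarrow>
     computable1 neg \<and> inj neg \<and>
     computable2 imp \<and> inj (case_prod imp) \<and>
     computable2 con \<and> inj (case_prod con) \<and>
     computable2 dis \<and> inj (case_prod dis) \<and>
     (\<forall>x. c \<in> app H {x, neg x}) \<and>
     (\<forall>x. app H {neg (neg x)} = app H {x}) \<and>
     (\<forall>x. dis x (neg x) \<in> app H {}) \<and>
     (\<forall>X x y. app H (X \<union> {dis x y}) = app H (X \<union> {x}) \<inter> app H (X \<union> {y})) \<and>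
     (\<forall>X x. c \<in> app H (X \<union> {x}) \<longrightarrow> neg x \<in> app H X) \<and>
     (\<forall>X x y. x \<in> app H (X \<union> {y}) \<longleftrightarrow> imp y x \<in> app H X)"

definition completion :: "(nat \<Rightarrow> nat) \<Rightarrow> nat set \<Rightarrow> bool" where
  "completion neg A \<longleftrightarrow> (\<forall>x. \<exists>!y. y \<in> A \<inter> {x, neg x})"

end

theory Submission
  imports Defs
begin

text \<open>In a loopless run every stack reaches a limit, and the final theses are \<open>app H L\<close> for the set
  \<open>L\<close> of all limit tops. The sentence \<open>neg cm\<close> can never be rejected, so it belongs to \<open>L\<close>; from then
  on deriving \<open>cm\<close> amounts to deriving \<open>c\<close>, hence every sentence outside \<open>L\<close> is refuted by \<open>L\<close>, which
  makes \<open>app H L\<close> a completion. Goodness of the approximation moreover yields \<open>c\<close> at the very stage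
  at which \<open>cm\<close> appears, so only finitely many positions are ever revised in the limit. Let \<open>F\<close> be the
  finite set of limit tops at those positions. Moving \<open>F\<close> to the front of the enumeration \<open>f\<close> is a
  finite, hence computable, modification, and the dialectical system with the same \<open>H\<close> and \<open>c\<close> and
  this new enumeration accepts exactly the elements of \<open>L\<close>.\<close>

section \<open>Finite modifications of computable functions\<close>

lemma computable1_shift:
  assumes "computable1 g"
  shows "computable1 (\<lambda>n. g (Suc n))"
proof -
  obtain p where p: "\<And>x. computes p [x] (g x)"
    using assms unfolding computable1_def by blast
  have "computes (Comp p [Comp Succ [Proj 0]]) [n] (g (Suc n))" for n
  proof (rule computes.Comp[where ys = "[Suc n]"])
    have "computes (Comp Succ [Proj 0]) [n] (Suc n)"
      by (rule computes.Comp[where ys = "[n]"])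
        (use computes.Proj[of 0 "[n]"] in \<open>auto intro: computes.Succ\<close>)
    then show "\<forall>i<length [Comp Succ [Proj 0]]. computes ([Comp Succ [Proj 0]] ! i) [n] ([Suc n] ! i)"
      by simp
  qed (use p in auto)
  then show ?thesis unfolding computable1_def by blast
qed

lemma const_computable: "\<exists>p. \<forall>xs. computes p xs a"
proof (induction a)
  case 0
  then show ?case using computes.Zero by blast
next
  case (Suc a)
  then obtain p where p: "\<And>xs. computes p xs a" by blast
  have "computes (Comp Succ [p]) xs (Suc a)" for xs
    by (rule computes.Comp[where ys = "[a]"]) (use p in \<open>auto intro: computes.Succ\<close>)
  then show ?case by blast
qed

text \<open>Primitive recursion serves as a case distinction: the base is the constant
  \<open>g 0\<close>, and the step ignores the recursive value and applies the program for the
  shifted function to the predecessor.\<close>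

lemma computable1_cases:
  assumes "computable1 (\<lambda>n. g (Suc n))"
  shows "computable1 g"
proof -
  obtain p where p: "\<And>x. computes p [x] (g (Suc x))"
    using assms unfolding computable1_def by blast
  obtain q where q: "\<And>xs. computes q xs (g 0)"
    using const_computable by blast
  have step: "computes (Comp p [Proj 0]) [n, y] (g (Suc n))" for n y
    by (rule computes.Comp[where ys = "[n]"])
      (use p computes.Proj[of 0 "[n, y]"] in auto)
  have "computes (PrimRec q (Comp p [Proj 0])) [n] (g n)" for n
  proof (induction n)
    case 0
    then show ?case using q by (rule computes.PrimRec_0)
  next
    case (Suc n)
    then show ?case using step by (rule computes.PrimRec_Suc)
  qed
  then show ?thesis unfolding computable1_def by blast
qed

text \<open>Arguments are peeled off one at a time: shifting both functions lowers \<open>k\<close>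
  by one, and the value at 0 is restored by \<open>computable1_cases\<close>.\<close>

lemma computable1_finite_modification:
  assumes "computable1 g" and "\<And>x. x \<ge> k \<Longrightarrow> g' x = g x"
  shows "computable1 g'"
  using assms
proof (induction k arbitrary: g g')
  case 0
  then have "g' = g" by auto
  then show ?case using 0 by simp
next
  case (Suc k)
  have "computable1 (\<lambda>n. g' (Suc n))"
    using Suc.IH[OF computable1_shift[OF Suc.prems(1)], of "\<lambda>n. g' (Suc n)"] Suc.prems(2) by simp
  then show ?case by (rule computable1_cases)
qed

section \<open>Rearranging an enumeration at finitely many places\<close>

lemma move_to_front:
  fixes f :: "nat \<Rightarrow> 'a"
  assumes "bij f"
  obtains g k where "bij g" "\<And>i. i > k \<Longrightarrow> g i = f i" "inv g a = 0"
    "\<And>x y. x \<noteq> a \<Longrightarrow> y \<noteq> a \<Longrightarrow> inv f x < inv f y \<Longrightarrow> inv g x < inv g y"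
    "\<And>x. x \<noteq> a \<Longrightarrow> 0 < inv g x"
proof -
  \<comment> \<open>\<open>k\<close> is the old position of \<open>a\<close>. \<open>\<tau>\<close>
    cycles the positions \<open>0..k\<close>, sending new positions to old ones, and
    \<open>\<tau>'\<close> is its inverse, so the elements other than \<open>a\<close> keep their
    relative order.\<close>
  define k where "k = inv f a"
  define \<tau> where "\<tau> i = (if i = 0 then k else if i \<le> k then i - 1 else i)" for i
  define \<tau>' where "\<tau>' j = (if j = k then 0 else if j < k then Suc j else j)" for j
  have inverse: "\<tau> (\<tau>' j) = j" "\<tau>' (\<tau> i) = i" for i j
    by (auto simp: \<tau>_def \<tau>'_def)
  then have \<tau>: "bij \<tau>" "inv \<tau> = \<tau>'"
    by (auto intro!: o_bij[of \<tau>'] inv_equality)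
  have inv_g: "inv (f \<circ> \<tau>) x = \<tau>' (inv f x)" for x
    using o_inv_distrib[OF assms \<tau>(1)] \<tau>(2) by simp
  have k: "inv f x = k \<longleftrightarrow> x = a" for x
    using assms by (metis k_def bij_inv_eq_iff)
  show thesis
  proof
    show "bij (f \<circ> \<tau>)" using assms \<tau>(1) by (rule bij_comp[rotated])
    show "(f \<circ> \<tau>) i = f i" if "i > k" for i
      using that by (simp add: \<tau>_def)
    show "inv (f \<circ> \<tau>) a = 0" unfolding inv_g by (simp add: \<tau>'_def k_def)
    show "inv (f \<circ> \<tau>) x < inv (f \<circ> \<tau>) y"
      if "x \<noteq> a" "y \<noteq> a" "inv f x < inv f y" for x y
      using that k[of x] k[of y] unfolding inv_g by (auto simp: \<tau>'_def)
    show "0 < inv (f \<circ> \<tau>) x" if "x \<noteq> a" for x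
      using that k[of x] unfolding inv_g by (auto simp: \<tau>'_def)
  qed
qed

text \<open>Each element of \<open>F\<close> is moved in turn to position 0, so it precedes
  everything outside \<open>F\<close>, while the order among the other elements survives. Here
  \<open>inv g x\<close> is the position of \<open>x\<close> in the enumeration
  \<open>g\<close>.\<close>

lemma move_finite_set_to_front:
  fixes f :: "nat \<Rightarrow> 'a"
  assumes "finite F" and "bij f"
  shows "\<exists>g k. bij g \<and> (\<forall>i>k. g i = f i) \<and> (\<forall>x\<in>F. \<forall>y. y \<notin> F \<longrightarrow> inv g x < inv g y) \<and>
    (\<forall>x y. x \<notin> F \<longrightarrow> y \<notin> F \<longrightarrow> inv f x < inv f y \<longrightarrow> inv g x < inv g y)"
  using assms(1)
proof induction
  case empty
  then show ?case using assms(2) by blast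
next
  case (insert a F)
  then obtain g k where g: "bij g" "\<forall>i>k. g i = f i"
      "\<And>x y. x \<in> F \<Longrightarrow> y \<notin> F \<Longrightarrow> inv g x < inv g y"
      "\<And>x y. x \<notin> F \<Longrightarrow> y \<notin> F \<Longrightarrow> inv f x < inv f y \<Longrightarrow> inv g x < inv g y"
    by blast
  obtain h j where h: "bij h" "\<And>i. i > j \<Longrightarrow> h i = g i" "inv h a = 0"
      "\<And>x y. x \<noteq> a \<Longrightarrow> y \<noteq> a \<Longrightarrow> inv g x < inv g y \<Longrightarrow> inv h x < inv h y"
      "\<And>x. x \<noteq> a \<Longrightarrow> 0 < inv h x"
    using move_to_front[OF g(1), of a] by blast
  show ?case
  proof (intro exI conjI allI ballI impI)
    show "bij h" by fact
    show "h i = f i" if "max j k < i" for i using that h(2) g(2) by simp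
    show "inv h x < inv h y" if "x \<in> insert a F" "y \<notin> insert a F" for x y
      using that g(3) h(3,4,5) by (cases "x = a") auto
    show "inv h x < inv h y" if "x \<notin> insert a F" "y \<notin> insert a F" "inv f x < inv f y" for x y
      using that g(4) h(4) by auto
  qed
qed

section \<open>Operators, tops of stacks and single steps\<close>

lemma app_mono: "H \<subseteq> H' \<Longrightarrow> X \<subseteq> Y \<Longrightarrow> app H X \<subseteq> app H' Y"
  unfolding app_def by blast

lemma app_subset_closed:
  assumes "closure_operator H" and "X \<subseteq> app H Y"
  shows "app H X \<subseteq> app H Y"
  using assms app_mono[of H H X "app H Y"] unfolding closure_operator_def by blast

lemma tops_mono: "x \<le> y \<Longrightarrow> tops r x \<subseteq> tops r y"
  unfolding tops_def by fastforce

lemma tops_0 [simp]: "tops r 0 = {}"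
  unfolding tops_def by simp

lemma tops_Suc: "tops r (Suc x) = (if r x = [] then tops r x else insert (last (r x)) (tops r x))"
  unfolding tops_def by (auto simp: less_Suc_eq)

lemma tops_cong: "(\<And>y. y < x \<Longrightarrow> r y = r' y) \<Longrightarrow> tops r x = tops r' x"
  unfolding tops_def by (metis (lifting))

lemma finite_tops: "finite (tops r x)"
  by (induction x) (auto simp: tops_Suc)

lemma last_in_tops: "y < x \<Longrightarrow> r y \<noteq> [] \<Longrightarrow> last (r y) \<in> tops r x"
  unfolding tops_def by blast

text \<open>Both acting cases concern the least position \<open>z\<close> at which \<open>c\<close>
  or \<open>cm\<close> is derived, and \<open>c\<close> wins there if both appear. Nothing is
  derived below \<open>z\<close>, so the side conditions on smaller positions hold
  automatically.\<close>

lemma q_step_conv_Least: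
  "q_step Hs f fm c cm (m, r) =
    (if \<exists>k\<le>m. {c, cm} \<inter> chi Hs r k \<noteq> {} then
       let z = LEAST k. {c, cm} \<inter> chi Hs r k \<noteq> {} in
         if c \<in> chi Hs r z then discard Hs f c z (m, r) else revise fm z (m, r)
     else extend f (m, r))"
proof (cases "\<exists>k\<le>m. {c, cm} \<inter> chi Hs r k \<noteq> {}")
  case True
  define z where "z = (LEAST k. {c, cm} \<inter> chi Hs r k \<noteq> {})"
  obtain k where k: "k \<le> m" "{c, cm} \<inter> chi Hs r k \<noteq> {}" using True by blast
  have z: "{c, cm} \<inter> chi Hs r z \<noteq> {}" "z \<le> k"
    unfolding z_def using k(2) by (rule LeastI, rule Least_le)
  have below: "c \<notin> chi Hs r j" "cm \<notin> chi Hs r j" if "j < z" for j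
    using not_less_Least[of j "\<lambda>k. {c, cm} \<inter> chi Hs r k \<noteq> {}"] that unfolding z_def by auto
  show ?thesis
  proof (cases "c \<in> chi Hs r z")
    case c: True
    have "(LEAST k. k \<le> m \<and> c \<in> chi Hs r k \<and> (\<forall>k'<k. cm \<notin> chi Hs r k')) = z"
    proof (rule Least_equality)
      show "z \<le> m \<and> c \<in> chi Hs r z \<and> (\<forall>k'<z. cm \<notin> chi Hs r k')"
        using c z k below by auto
    qed (use below(1) in \<open>meson not_less\<close>)
    moreover have "\<exists>k\<le>m. c \<in> chi Hs r k \<and> (\<forall>k'<k. cm \<notin> chi Hs r k')"
      by (rule exI[of _ z]) (use c z k below in auto)
    ultimately show ?thesis using True c
      unfolding q_step.simps Let_def z_def[symmetric]
      by (simp only: if_True if_False not_True_eq_False not_False_eq_True)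
  next
    case c: False
    then have cm: "cm \<in> chi Hs r z" using z by blast
    have "(LEAST k. k \<le> m \<and> cm \<in> chi Hs r k \<and> (\<forall>k'\<le>k. c \<notin> chi Hs r k')) = z"
    proof (rule Least_equality)
      show "z \<le> m \<and> cm \<in> chi Hs r z \<and> (\<forall>k'\<le>z. c \<notin> chi Hs r k')"
        using c cm z k below by (auto simp: le_less)
    qed (use below(2) in \<open>meson not_less\<close>)
    moreover have "\<not> (\<exists>k\<le>m. c \<in> chi Hs r k \<and> (\<forall>k'<k. cm \<notin> chi Hs r k'))"
    proof clarify
      fix k assume k: "c \<in> chi Hs r k" "\<forall>k'<k. cm \<notin> chi Hs r k'"
      then have "k \<le> z" using cm by (meson not_less)
      then show False using k(1) c below by (metis le_less)
    qed
    ultimately show ?thesis using True c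
      unfolding q_step.simps Let_def z_def[symmetric]
      by (simp only: if_True if_False not_True_eq_False not_False_eq_True)
  qed
next
  case False
  then show ?thesis unfolding q_step.simps by (simp only: if_False not_False_eq_True if_True)
qed

text \<open>With \<open>cm = c\<close> the revising branch is never taken, so results on \<open>q\<close>-runs cover dialectical ones.\<close>

lemma d_step_conv_q_step: "d_step Hs f c (m, r) = q_step Hs f fm c c (m, r)"
proof (cases "\<exists>k\<le>m. c \<in> chi Hs r k")
  case True
  then obtain k where k: "k \<le> m" "c \<in> chi Hs r k" by blast
  define z where "z = (LEAST k. c \<in> chi Hs r k)"
  have z: "c \<in> chi Hs r z" "z \<le> k"
    unfolding z_def using k(2) by (rule LeastI, rule Least_le)
  have "(LEAST k. k \<le> m \<and> c \<in> chi Hs r k) = z"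
    by (rule Least_equality) (use z k in \<open>auto simp: z_def intro: Least_le\<close>)
  then show ?thesis using True z(1)
    unfolding d_step.simps q_step_conv_Least Let_def
    by (simp add: z_def[symmetric])
next
  case False
  then show ?thesis unfolding q_step_conv_Least by auto
qed

lemma d_state_conv_q_state: "d_state \<alpha> f c s = q_state \<alpha> f fm c c s"
proof (induction s)
  case (Suc s)
  then show ?case
    using d_step_conv_q_step by (metis d_state.simps(2) q_state.simps(2) surj_pair)
qed simp

text \<open>If two iterates agreed, the orbit would never leave its first \<open>b\<close> values
  and hence be finite.\<close>

lemma acyclic_inj:
  assumes "acyclic_fun g"
  shows "inj (\<lambda>n. (g ^^ n) x)"
proof -
  have "(g ^^ a) x \<noteq> (g ^^ b) x" if "a < b" for a b
  proof
    assume eq: "(g ^^ a) x = (g ^^ b) x"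
    have "(g ^^ n) x \<in> (\<lambda>n. (g ^^ n) x) ` {..<b}" for n
    proof (induction n)
      case 0
      then show ?case using that by (intro image_eqI[of _ _ 0]) auto
    next
      case (Suc n)
      then obtain k where k: "k < b" "(g ^^ n) x = (g ^^ k) x" by blast
      then have "(g ^^ Suc n) x = (g ^^ Suc k) x" by simp
      moreover have "(g ^^ Suc k) x \<in> (\<lambda>n. (g ^^ n) x) ` {..<b}"
      proof (cases "Suc k = b")
        case True
        then show ?thesis using eq that by (intro image_eqI[of _ _ a]) auto
      next
        case False
        then show ?thesis using k(1) by (intro imageI) simp
      qed
      ultimately show ?case by metis
    qed
    then have "range (\<lambda>n. (g ^^ n) x) \<subseteq> (\<lambda>n. (g ^^ n) x) ` {..<b}" by blast
    then have "finite (range (\<lambda>n. (g ^^ n) x))" by (rule finite_subset) simp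
    then show False using assms unfolding acyclic_fun_def by blast
  qed
  then show ?thesis by (metis (mono_tags, lifting) injI linorder_neqE_nat)
qed

section \<open>Invariants of q-runs\<close>

locale q_run =
  fixes \<alpha> :: "nat \<Rightarrow> nat set" and H :: "nat set" and f fm :: "nat \<Rightarrow> nat" and c cm :: nat
  assumes increasing: "\<alpha> s \<subseteq> \<alpha> (Suc s)"
    and union: "(\<Union>s. \<alpha> s) = H"
    and closure: "closure_operator H"
    and consistent: "c \<notin> app H {}" "cm \<notin> app H {}"
    and surj: "surj f"
begin

abbreviation m :: "nat \<Rightarrow> nat" where "m s \<equiv> fst (q_state \<alpha> f fm c cm s)"
abbreviation r :: "nat \<Rightarrow> nat \<Rightarrow> nat list" where "r s \<equiv> snd (q_state \<alpha> f fm c cm s)"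

declare q_state.simps(2) [simp del]

lemma mono_\<alpha>: "s \<le> t \<Longrightarrow> \<alpha> s \<subseteq> \<alpha> t"
  using lift_Suc_mono_le[of \<alpha>, OF increasing] by blast

lemma \<alpha>_le: "\<alpha> s \<subseteq> H"
  using union by blast

lemma app_stage:
  assumes "x \<in> app H X"
  shows "\<exists>t. \<forall>s\<ge>t. x \<in> app (\<alpha> s) X"
proof -
  obtain D where D: "finite D" "D \<subseteq> X" "prod_encode (x, set_encode D) \<in> H"
    using assms unfolding app_def by blast
  then obtain t where "prod_encode (x, set_encode D) \<in> \<alpha> t" using union by blast
  then have "\<forall>s\<ge>t. x \<in> app (\<alpha> s) X"
    using D mono_\<alpha> unfolding app_def by blast
  then show ?thesis by blast
qed

text \<open>Consistency rules out the reset inside \<open>discard\<close> and forces a nonempty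
  stack at the acting position, which leaves three explicit transitions.\<close>

lemma step_cases:
  obtains (extend) "\<And>k. k \<le> m s \<Longrightarrow> {c, cm} \<inter> chi (\<alpha> s) (r s) k = {}"
    "m (Suc s) = Suc (m s)"
    "\<And>x. r (Suc s) x = (if x \<le> m s then r s x else if x = Suc (m s) then [f (Suc (m s))] else [])"
  | (discard) z where "z \<le> m s" "r s z \<noteq> []"
    "\<And>k. k < z \<Longrightarrow> {c, cm} \<inter> chi (\<alpha> s) (r s) k = {}" "c \<in> chi (\<alpha> s) (r s) z"
    "m (Suc s) = Suc z"
    "\<And>x. r (Suc s) x = (if x < z then r s x else if x = Suc z then [f (Suc z)] else [])"
  | (revise) z where "z \<le> m s" "r s z \<noteq> []"
    "\<And>k. k < z \<Longrightarrow> {c, cm} \<inter> chi (\<alpha> s) (r s) k = {}"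
    "c \<notin> chi (\<alpha> s) (r s) z" "cm \<in> chi (\<alpha> s) (r s) z"
    "m (Suc s) = z"
    "\<And>x. r (Suc s) x =
      (if x < z then r s x else if x = z then r s z @ [fm (last (r s z))] else [])"
proof -
  let ?P = "\<lambda>k. {c, cm} \<inter> chi (\<alpha> s) (r s) k \<noteq> {}"
  have state: "q_state \<alpha> f fm c cm (Suc s) = q_step (\<alpha> s) f fm c cm (m s, r s)"
    by (simp add: q_state.simps(2))
  show thesis
  proof (cases "\<exists>k\<le>m s. ?P k")
    case False
    then have "q_state \<alpha> f fm c cm (Suc s) = Defs.extend f (m s, r s)"
      unfolding state q_step_conv_Least by (simp only: if_False)
    then show thesis using False by (intro extend) (auto simp del: prod.collapse)
  next
    case True
    then obtain k where k: "k \<le> m s" "?P k" by blast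
    define z where "z = (LEAST k. ?P k)"
    have z: "?P z" unfolding z_def using k(2) by (rule LeastI)
    have "z \<le> k" unfolding z_def using k(2) by (rule Least_le)
    then have zm: "z \<le> m s" using k(1) by simp
    have below: "{c, cm} \<inter> chi (\<alpha> s) (r s) j = {}" if "j < z" for j
      using not_less_Least[of j ?P] that unfolding z_def by blast
    have empty: "c \<notin> app (\<alpha> s) {}" "cm \<notin> app (\<alpha> s) {}"
      using consistent app_mono[OF \<alpha>_le order_refl] by blast+
    \<comment> \<open>An empty stack contributes no top, so \<open>z\<close> would derive no more
      than its predecessor, or for \<open>z = 0\<close> no more than the empty set.\<close>
    have nonempty: "r s z \<noteq> []"
    proof
      assume 0: "r s z = []"
      show False
      proof (cases z)
        case 0
        then show False using z \<open>r s z = []\<close> empty by (auto simp: chi_def tops_Suc)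
      next
        case (Suc j)
        then have "chi (\<alpha> s) (r s) z = chi (\<alpha> s) (r s) j"
          using 0 by (simp add: chi_def tops_Suc)
        then show False using below[of j] z Suc by simp
      qed
    qed
    have step: "q_state \<alpha> f fm c cm (Suc s) =
       (if c \<in> chi (\<alpha> s) (r s) z then Defs.discard (\<alpha> s) f c z (m s, r s)
        else Defs.revise fm z (m s, r s))"
      using True
      unfolding state q_step_conv_Least Let_def z_def[symmetric]
      by (simp only: if_True)
    show thesis
    proof (cases "c \<in> chi (\<alpha> s) (r s) z")
      case c: True
      show thesis by (rule discard[of z]) (use c step zm nonempty below empty in \<open>auto simp del: prod.collapse\<close>)
    next
      case c: False
      then have "cm \<in> chi (\<alpha> s) (r s) z" using z by blast
      then show thesis by (intro revise[of z]) (use c step zm nonempty below in \<open>auto simp del: prod.collapse\<close>)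
    qed
  qed
qed

text \<open>A refutation of \<open>f x\<close> is recorded with the full \<open>H\<close> and the
  tops below \<open>x\<close>, so it persists while those stacks stay; a step that changes a lower
  stack restarts the positions above it.\<close>

lemma run_invariant:
  "r s (m s) \<noteq> [] \<and> (\<forall>x>m s. r s x = []) \<and>
   (\<forall>x\<le>m s. (r s x \<noteq> [] \<and> last (r s x) = f x) \<or>
     {c, cm} \<inter> app H (insert (f x) (tops (r s) x)) \<noteq> {})"
  (is "?I s")
proof (induction s)
  case 0
  then show ?case by (simp add: initial_def)
next
  case (Suc s)
  let ?Q = "\<lambda>s x. {c, cm} \<inter> app H (insert (f x) (tops (r s) x)) \<noteq> {}"
  \<comment> \<open>If \<open>z\<close> still shows \<open>f z\<close>, everything derived at
    \<open>z\<close> comes from \<open>f z\<close> and the tops below; so the position acted on is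
    always refuted.\<close>
  have refuted: "?Q s z" if "{c, cm} \<inter> chi (\<alpha> s) (r s) z \<noteq> {}" "z \<le> m s" for z
  proof (cases "?Q s z")
    case False
    then have "r s z \<noteq> [] \<and> last (r s z) = f z" using Suc that(2) by blast
    then have "chi (\<alpha> s) (r s) z \<subseteq> app H (insert (f z) (tops (r s) z))"
      unfolding chi_def using app_mono[OF \<alpha>_le order_refl] by (simp add: tops_Suc)
    then show ?thesis using that(1) by blast
  qed
  show ?case
  proof (cases rule: step_cases[of s])
    case extend
    have tops: "tops (r (Suc s)) x = tops (r s) x" if "x \<le> Suc (m s)" for x
      by (rule tops_cong) (use that extend(3) in simp)
    have "(r (Suc s) x \<noteq> [] \<and> last (r (Suc s) x) = f x) \<or> ?Q (Suc s) x" if "x \<le> Suc (m s)" for x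
    proof (cases "x \<le> m s")
      case True
      then show ?thesis using Suc extend(3) tops[of x] by auto
    next
      case False
      then have "x = Suc (m s)" using that by simp
      then show ?thesis using extend(3) by simp
    qed
    moreover have "r (Suc s) (m (Suc s)) \<noteq> [] \<and> (\<forall>x>m (Suc s). r (Suc s) x = [])"
      using extend(2,3) by simp
    ultimately show ?thesis using extend(2) by simp
  next
    case (discard z)
    have tops: "tops (r (Suc s)) x = tops (r s) x" if "x \<le> z" for x
      by (rule tops_cong) (use that discard in simp)
    have Qz: "?Q (Suc s) z" using refuted[of z] discard(1,4) tops[of z] by auto
    have "(r (Suc s) x \<noteq> [] \<and> last (r (Suc s) x) = f x) \<or> ?Q (Suc s) x" if "x \<le> Suc z" for x
    proof -
      consider "x < z" | "x = z" | "x = Suc z" using \<open>x \<le> Suc z\<close> by linarith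
      then show ?thesis
      proof cases
        case 1
        then show ?thesis using Suc discard(1,6) tops[of x] by auto
      qed (use Qz discard(6) in auto)
    qed
    moreover have "r (Suc s) (m (Suc s)) \<noteq> [] \<and> (\<forall>x>m (Suc s). r (Suc s) x = [])"
      using discard(5,6) by simp
    ultimately show ?thesis using discard(5) by simp
  next
    case (revise z)
    have tops: "tops (r (Suc s)) x = tops (r s) x" if "x \<le> z" for x
      by (rule tops_cong) (use that revise in simp)
    have Qz: "?Q (Suc s) z" using refuted[of z] revise(1,5) tops[of z] by auto
    have "(r (Suc s) x \<noteq> [] \<and> last (r (Suc s) x) = f x) \<or> ?Q (Suc s) x" if "x \<le> z" for x
    proof (cases "x = z")
      case False
      then have "x < z" using that by simp
      then show ?thesis using Suc revise(1,7) tops[of x] by auto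
    qed (use Qz in simp)
    moreover have "r (Suc s) (m (Suc s)) \<noteq> [] \<and> (\<forall>x>m (Suc s). r (Suc s) x = [])"
      using revise(2,6,7) by simp
    ultimately show ?thesis using revise(6) by simp
  qed
qed

text \<open>The stack at \<open>u\<close> lists the successive iterates of \<open>fm\<close> on
  \<open>f u\<close>, so its height determines its top.\<close>

lemma last_stack:
  "r s u \<noteq> [] \<Longrightarrow> last (r s u) = (fm ^^ (length (r s u) - 1)) (f u)"
proof (induction s arbitrary: u)
  case 0
  then show ?case by (cases "u = 0") (simp_all add: initial_def)
next
  case (Suc s)
  show ?case
  proof (cases rule: step_cases[of s])
    case extend
    then show ?thesis using Suc.IH[of u] Suc.prems by (simp split: if_splits)
  next
    case (discard z)
    then show ?thesis using Suc.IH[of u] Suc.prems by (simp split: if_splits)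
  next
    case (revise z)
    show ?thesis
    proof (cases "u = z")
      case True
      obtain n where "length (r s z) = Suc n" using revise(2) by (cases "r s z") auto
      then show ?thesis using revise(7)[of u] Suc.IH[OF revise(2)] True by simp
    next
      case False
      then show ?thesis using revise(7)[of u] Suc.IH[of u] Suc.prems by (simp split: if_splits)
    qed
  qed
qed

text \<open>By acyclicity different heights give different tops, hence finitely many tops mean
  finitely many heights.\<close>

lemma loopless_bounded:
  assumes "loopless \<alpha> f fm c cm" and "acyclic_fun fm"
  shows "\<exists>B. \<forall>s. length (r s u) \<le> B"
proof -
  let ?L = "{length (r s u) - 1 | s. r s u \<noteq> []}"
  have "(\<lambda>n. (fm ^^ n) (f u)) ` ?L \<subseteq> {last (r s u) | s. r s u \<noteq> []}"
  proof clarify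
    fix s assume "r s u \<noteq> []"
    then show "\<exists>s'. (fm ^^ (length (r s u) - 1)) (f u) = last (r s' u) \<and> r s' u \<noteq> []"
      using last_stack[of s u] by (intro exI[of _ s]) simp
  qed
  then have "finite ((\<lambda>n. (fm ^^ n) (f u)) ` ?L)"
    using assms(1) finite_subset unfolding loopless_def by blast
  then have "finite ?L"
    by (rule finite_imageD) (rule inj_on_subset[OF acyclic_inj[OF assms(2)] subset_UNIV])
  then obtain B where "\<forall>n\<in>?L. n \<le> B"
    unfolding finite_nat_set_iff_bounded_le by (rule exE)
  then have B: "length (r s u) - 1 \<le> B" if "r s u \<noteq> []" for s
    using that by blast
  have "length (r s u) \<le> Suc B" for s
    using B[of s] by (cases "r s u = []") auto
  then show ?thesis by blast
qed

end

section \<open>Limits of runs with bounded stacks\<close>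

locale bounded_run = q_run +
  assumes bounded: "\<exists>B. \<forall>s. length (r s u) \<le> B"
begin

text \<open>Once all stacks below \<open>x\<close> are fixed, a step can only keep the stack at
  \<open>x\<close>, empty it for good, or lengthen it; the bound allows finitely many
  lengthenings.\<close>

lemma stack_stabilises:
  assumes "\<And>s. s \<ge> t \<Longrightarrow> (\<forall>y<x. r s y = R y) \<and> x \<le> m s"
  shows "\<exists>l t'. \<forall>s\<ge>t'. r s x = l \<and> Suc x \<le> m s"
proof -
  have move: "(r (Suc s) x = r s x \<and> Suc x \<le> m (Suc s)) \<or> (r s x \<noteq> [] \<and> r (Suc s) x = []) \<or>
      (r s x \<noteq> [] \<and> length (r (Suc s) x) = Suc (length (r s x)))" if "s \<ge> t" for s
  proof (cases rule: step_cases[of s])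
    case extend
    then show ?thesis using assms[OF that] by simp
  next
    case (discard z)
    \<comment> \<open>Acting at \<open>z < x\<close> would change a stack that is already
      settled.\<close>
    have "x \<le> z"
    proof (rule ccontr)
      assume "\<not> x \<le> z"
      then have "r (Suc s) z = r s z" using assms[of s] assms[of "Suc s"] that by simp
      then show False using discard(2,6) by simp
    qed
    then show ?thesis using discard(2,5,6) by (cases "x = z") auto
  next
    case (revise z)
    have "x \<le> z"
    proof (rule ccontr)
      assume "\<not> x \<le> z"
      then have "r (Suc s) z = r s z" using assms[of s] assms[of "Suc s"] that by simp
      then show False using revise(7) by simp
    qed
    then show ?thesis using revise(2,6,7) by (cases "x = z") auto
  qed
  have stay: "\<exists>l t'. \<forall>s\<ge>t'. r s x = l \<and> Suc x \<le> m s"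
    if "u \<ge> t" and *: "\<And>s. s \<ge> u \<Longrightarrow> r (Suc s) x = r s x \<and> Suc x \<le> m (Suc s)" for u
  proof -
    have "r s x = r u x" if "s \<ge> u" for s
      using that
    proof (induction rule: dec_induct)
      case (step n)
      then show ?case using *[of n] by simp
    qed simp
    \<comment> \<open>The bound on \<open>m\<close> starts one stage after \<open>u\<close>, since
      the hypothesis speaks of \<open>m (Suc s)\<close>.\<close>
    moreover have "Suc x \<le> m s" if "s \<ge> Suc u" for s
    proof -
      obtain n where n: "s = Suc n" "u \<le> n" using \<open>s \<ge> Suc u\<close> by (cases s) auto
      then show ?thesis using *[of n] by simp
    qed
    ultimately have "\<forall>s\<ge>Suc u. r s x = r u x \<and> Suc x \<le> m s"
      using Suc_leD by blast
    then show ?thesis by blast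
  qed
  show ?thesis
  proof (cases "\<exists>u\<ge>t. r u x = []")
    case True
    then obtain u where u: "u \<ge> t" "r u x = []" by blast
    have "r s x = []" if "s \<ge> u" for s
      using that
    proof (induction rule: dec_induct)
      case (step n)
      then show ?case using u(1) move[of n] by auto
    qed (use u in simp)
    then show ?thesis using stay[OF u(1)] move u(1) by (meson order_trans)
  next
    case False
    obtain B where B: "\<And>s. length (r s x) \<le> B" using bounded by blast
    \<comment> \<open>The stack is never empty from \<open>t\<close> on, so its height only grows; a
      stage \<open>u\<close> of maximal height is followed by no change.\<close>
    let ?N = "(\<lambda>s. length (r s x)) ` {t..}"
    have fin: "finite ?N" using B by (intro finite_subset[OF _ finite_atMost[of B]]) auto
    then have "Max ?N \<in> ?N" by (intro Max_in) auto
    then obtain u where u: "u \<ge> t" "length (r u x) = Max ?N" by auto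
    have max: "length (r s x) \<le> length (r u x)" if "s \<ge> u" for s
      using fin u that by (auto intro!: Max_ge)
    have grow: "(r (Suc s) x = r s x \<and> Suc x \<le> m (Suc s)) \<or>
        length (r (Suc s) x) = Suc (length (r s x))" if "s \<ge> t" for s
      using move[OF that] False that by auto
    have const: "length (r s x) = length (r u x)" if "s \<ge> u" for s
      using that
    proof (induction rule: dec_induct)
      case (step n)
      then show ?case using grow[of n] u(1) max[of "Suc n"] by auto
    qed simp
    show ?thesis
    proof (rule stay[OF u(1)])
      show "r (Suc s) x = r s x \<and> Suc x \<le> m (Suc s)" if "s \<ge> u" for s
        using grow[of s] const[of s] const[of "Suc s"] that u(1) by auto
    qed
  qed
qed

lemma converges: "\<exists>R. \<forall>x. \<exists>t. \<forall>s\<ge>t. (\<forall>y<x. r s y = R y) \<and> x \<le> m s"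
proof -
  define R where "R y = (THE l. \<exists>t. \<forall>s\<ge>t. r s y = l)" for y
  have R: "R y = l" if "\<forall>s\<ge>t. r s y = l" for y l t
    unfolding R_def
  proof (rule the_equality)
    fix l' assume "\<exists>t. \<forall>s\<ge>t. r s y = l'"
    then obtain t' where "\<forall>s\<ge>t'. r s y = l'" by blast
    then show "l' = l" using that by (metis max.cobounded1 max.cobounded2)
  qed (use that in blast)
  have "\<exists>t. \<forall>s\<ge>t. (\<forall>y<x. r s y = R y) \<and> x \<le> m s" for x
  proof (induction x)
    case (Suc x)
    then obtain t where t: "\<And>s. s \<ge> t \<Longrightarrow> (\<forall>y<x. r s y = R y) \<and> x \<le> m s" by blast
    obtain l t' where t': "\<forall>s\<ge>t'. r s x = l \<and> Suc x \<le> m s"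
      using stack_stabilises[OF t] by blast
    then have "R x = l" by (intro R) auto
    then show ?case using t t' by (intro exI[of _ "max t t'"]) (auto simp: less_Suc_eq)
  qed simp
  then show ?thesis by blast
qed

definition limit :: "nat \<Rightarrow> nat list" where
  "limit = (SOME R. \<forall>x. \<exists>t. \<forall>s\<ge>t. (\<forall>y<x. r s y = R y) \<and> x \<le> m s)"

lemma limit:
  obtains t where "\<And>s y. s \<ge> t \<Longrightarrow> y < x \<Longrightarrow> r s y = limit y" "\<And>s. s \<ge> t \<Longrightarrow> x \<le> m s"
  using someI_ex[OF converges] unfolding limit_def[symmetric] by blast

text \<open>If settled tops derived \<open>c\<close> or \<open>cm\<close>, some late step would have
  to act at a position below \<open>x\<close> and change a stack that no longer changes.\<close>

lemma limit_consistent: "{c, cm} \<inter> app H (tops limit x) = {}"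
proof (cases x)
  case 0
  then show ?thesis using consistent by auto
next
  case (Suc k)
  show ?thesis
  proof (rule ccontr)
    assume "\<not> ?thesis"
    then obtain d where d: "d \<in> {c, cm}" "d \<in> app H (tops limit x)" by blast
    obtain u where u: "\<And>s. s \<ge> u \<Longrightarrow> d \<in> app (\<alpha> s) (tops limit x)"
      using app_stage[OF d(2)] by blast
    obtain t where t: "\<And>s y. s \<ge> t \<Longrightarrow> y < x \<Longrightarrow> r s y = limit y" "\<And>s. s \<ge> t \<Longrightarrow> x \<le> m s"
      using limit by blast
    define s where "s = max t u"
    have "tops (r s) x = tops limit x" by (rule tops_cong) (use t s_def in simp)
    then have k: "{c, cm} \<inter> chi (\<alpha> s) (r s) k \<noteq> {}"
      using d(1) u[of s] s_def Suc by (auto simp: chi_def)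
    have stable: "r (Suc s) y = r s y" if "y \<le> k" for y
      using t(1)[of s y] t(1)[of "Suc s" y] that Suc by (simp add: s_def)
    have "k \<le> m s" using t(2)[of s] Suc by (simp add: s_def)
    show False
    proof (cases rule: step_cases[of s])
      case extend
      then show False using k \<open>k \<le> m s\<close> by blast
    next
      case (discard z)
      have "z \<le> k" using discard(3) k by (meson not_less)
      then show False using stable[of z] discard(2,6) by simp
    next
      case (revise z)
      have "z \<le> k" using revise(3) k by (meson not_less)
      then show False using stable[of z] revise(7) by simp
    qed
  qed
qed

text \<open>This is the last clause of \<open>run_invariant\<close>, read at a stage where the
  stacks up to \<open>x\<close> are final and \<open>m\<close> lies beyond \<open>x\<close>.\<close>

lemma limit_rejected:
  assumes "\<not> (limit x \<noteq> [] \<and> last (limit x) = f x)"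
  shows "{c, cm} \<inter> app H (insert (f x) (tops limit x)) \<noteq> {}"
proof -
  obtain t where t: "\<And>s y. s \<ge> t \<Longrightarrow> y < Suc x \<Longrightarrow> r s y = limit y" "\<And>s. s \<ge> t \<Longrightarrow> Suc x \<le> m s"
    using limit by blast
  have "tops (r t) x = tops limit x" by (rule tops_cong) (use t in simp)
  then show ?thesis using run_invariant[of t] t(1)[of t x] t(2)[of t] assms Suc_leD
    by (metis lessI order_refl)
qed

definition all_tops :: "nat set" where "all_tops = (\<Union>x. tops limit x)"

text \<open>Compactness: a derivation uses a finite set, and the sets \<open>tops limit x\<close>
  increase with \<open>x\<close>.\<close>

lemma app_all_tops:
  assumes "a \<in> app H all_tops"
  shows "\<exists>x. a \<in> app H (tops limit x)"
proof -
  obtain D where D: "finite D" "D \<subseteq> all_tops" "prod_encode (a, set_encode D) \<in> H"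
    using assms unfolding app_def by blast
  have "\<exists>x. D \<subseteq> tops limit x" using D(1,2)
  proof (induction D)
    case (insert d D)
    then obtain x y where "D \<subseteq> tops limit x" "d \<in> tops limit y"
      unfolding all_tops_def by blast
    then have "insert d D \<subseteq> tops limit (max x y)"
      using tops_mono[of x "max x y" limit] tops_mono[of y "max x y" limit] by auto
    then show ?case by blast
  qed simp
  then show ?thesis using D unfolding app_def by blast
qed

lemma all_tops_consistent: "c \<notin> app H all_tops" "cm \<notin> app H all_tops"
  using app_all_tops limit_consistent by blast+

text \<open>Since \<open>m\<close> tends to infinity, its minimum \<open>n\<close> over the stages
  from \<open>t\<close> on is attained finitely often. At the last such stage the stacks below
  \<open>n\<close> are final, because later steps keep \<open>m\<close> above \<open>n\<close> and
  so act only at or beyond \<open>n\<close>.\<close>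

lemma settled_stage:
  obtains s where "s \<ge> t" "\<And>y. y < m s \<Longrightarrow> r s y = limit y"
proof -
  define n where "n = (LEAST k. \<exists>s\<ge>t. m s = k)"
  have n: "\<exists>s\<ge>t. m s = n" unfolding n_def by (rule LeastI) blast
  have least: "n \<le> m s" if "s \<ge> t" for s
    unfolding n_def by (rule Least_le) (use that in blast)
  obtain u where u: "\<And>s y. s \<ge> u \<Longrightarrow> y < Suc n \<Longrightarrow> r s y = limit y" "\<And>s. s \<ge> u \<Longrightarrow> Suc n \<le> m s"
    using limit by blast
  have "s < u" if "m s = n" for s
    using u(2)[of s] that by (cases "s < u") auto
  then have "{s. s \<ge> t \<and> m s = n} \<subseteq> {..<u}" by auto
  then have fin: "finite {s. s \<ge> t \<and> m s = n}" by (rule finite_subset) simp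
  define s where "s = Max {s. s \<ge> t \<and> m s = n}"
  have s: "s \<ge> t" "m s = n" using Max_in[OF fin] n unfolding s_def by auto
  have above: "n < m v" if "v > s" for v
  proof -
    have "m v \<noteq> n" using Max_ge[OF fin, of v] that s(1) unfolding s_def[symmetric] by auto
    then show ?thesis using least[of v] that s(1) by simp
  qed
  have stable: "r v y = r s y" if "v \<ge> s" "y < n" for v y
    using that(1)
  proof (induction rule: dec_induct)
    case (step v)
    have "n \<le> m v" using least[of v] s(1) step(1) by simp
    have "n < m (Suc v)" using above step(1) by simp
    have "r (Suc v) y = r v y"
    proof (cases rule: step_cases[of v])
      case extend
      then show ?thesis using \<open>n \<le> m v\<close> \<open>y < n\<close> by simp
    next
      case (discard z)
      then show ?thesis using \<open>n < m (Suc v)\<close> \<open>y < n\<close> by simp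
    next
      case (revise z)
      then show ?thesis using \<open>n < m (Suc v)\<close> \<open>y < n\<close> by simp
    qed
    then show ?case using step.IH by simp
  qed simp
  show thesis
  proof
    show "s \<ge> t" by fact
    fix y assume "y < m s"
    obtain u where "\<And>v z. v \<ge> u \<Longrightarrow> z < Suc y \<Longrightarrow> r v z = limit z" "\<And>v. v \<ge> u \<Longrightarrow> Suc y \<le> m v"
      using limit by blast
    then show "r s y = limit y"
      using stable[of "max s u" y] \<open>y < m s\<close> s(2) by simp
  qed
qed

lemma theses_eq: "q_theses \<alpha> f fm c cm = app H all_tops"
proof (intro equalityI subsetI)
  fix a assume "a \<in> q_theses \<alpha> f fm c cm"
  then obtain t where t: "\<And>s. s \<ge> t \<Longrightarrow> a \<in> prov_theses \<alpha> (q_state \<alpha> f fm c cm) s"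
    unfolding q_theses_def final_theses_def by blast
  \<comment> \<open>Other stages may contain stacks that change later; at a settled stage every top
    that contributes to the provisional theses is a limit top.\<close>
  obtain s where s: "s \<ge> t" "\<And>y. y < m s \<Longrightarrow> r s y = limit y" using settled_stage by blast
  obtain i where i: "i < m s" "a \<in> chi (\<alpha> s) (r s) i"
    using t[OF s(1)] unfolding prov_theses_def by blast
  have "tops (r s) (Suc i) = tops limit (Suc i)" by (rule tops_cong) (use s i in simp)
  then have "chi (\<alpha> s) (r s) i \<subseteq> app H all_tops"
    unfolding chi_def all_tops_def by (intro app_mono[OF \<alpha>_le]) auto
  then show "a \<in> app H all_tops" using i by blast
next
  fix a assume "a \<in> app H all_tops"
  then obtain x where "a \<in> app H (tops limit x)" using app_all_tops by blast
  \<comment> \<open>Index \<open>x\<close> of \<open>chi\<close> uses the tops below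
    \<open>x + 1\<close>, and it counts for the provisional theses once \<open>m s\<close> is at
    least \<open>Suc x\<close>.\<close>
  then have "a \<in> app H (tops limit (Suc x))"
    using app_mono[OF order_refl tops_mono[of x "Suc x"]] by auto
  then obtain u where u: "\<And>s. s \<ge> u \<Longrightarrow> a \<in> app (\<alpha> s) (tops limit (Suc x))"
    using app_stage by blast
  obtain t where t: "\<And>s y. s \<ge> t \<Longrightarrow> y < Suc x \<Longrightarrow> r s y = limit y" "\<And>s. s \<ge> t \<Longrightarrow> Suc x \<le> m s"
    using limit by blast
  have "a \<in> prov_theses \<alpha> (q_state \<alpha> f fm c cm) s" if "s \<ge> max t u" for s
  proof -
    have "tops (r s) (Suc x) = tops limit (Suc x)" by (rule tops_cong) (use t that in simp)
    then have "a \<in> chi (\<alpha> s) (r s) x" using u that by (simp add: chi_def)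
    then show ?thesis using t(2)[of s] that unfolding prov_theses_def by auto
  qed
  moreover obtain w where "a = f w" using surj by (metis surjD)
  ultimately show "a \<in> q_theses \<alpha> f fm c cm"
    unfolding q_theses_def final_theses_def by blast
qed

lemma tops_limit_subset: "tops limit x \<subseteq> all_tops"
  unfolding all_tops_def by blast

lemma all_topsI: "limit x \<noteq> [] \<Longrightarrow> last (limit x) \<in> all_tops"
  using last_in_tops[of x "Suc x" limit] tops_limit_subset by blast

end

section \<open>Negation and completeness of the limit\<close>

locale bounded_run_with_negation = bounded_run +
  fixes neg :: "nat \<Rightarrow> nat"
  assumes neg_contradicts: "c \<in> app H {x, neg x}"
    and double_neg: "app H {neg (neg x)} = app H {x}"
    and neg_intro: "c \<in> app H (insert x X) \<Longrightarrow> neg x \<in> app H X"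
begin

lemma reflexive: "X \<subseteq> app H X"
  using closure unfolding closure_operator_def by blast

text \<open>With \<open>neg cm\<close> at hand, a derivation of \<open>cm\<close> completes a
  contradictory pair.\<close>

lemma contradiction_from_cm:
  assumes "{c, cm} \<inter> app H X \<noteq> {}" and "neg cm \<in> X"
  shows "c \<in> app H X"
proof (cases "c \<in> app H X")
  case False
  then have "{cm, neg cm} \<subseteq> app H X" using assms reflexive by blast
  then have "app H {cm, neg cm} \<subseteq> app H X" by (rule app_subset_closed[OF closure])
  then show ?thesis using neg_contradicts by blast
qed

text \<open>If \<open>neg cm\<close> were rejected at its position, it would yield \<open>c\<close>
  over the tops below; these would then derive \<open>neg (neg cm)\<close>, hence \<open>cm\<close>,
  which \<open>limit_consistent\<close> forbids.\<close>

lemma neg_cm_in_limit: "\<exists>v. neg cm \<in> tops limit v"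
proof -
  obtain v where v: "f v = neg cm" using surj by (metis surjD)
  have "limit v \<noteq> [] \<and> last (limit v) = f v"
  proof (rule ccontr)
    assume "\<not> (limit v \<noteq> [] \<and> last (limit v) = f v)"
    then have "{c, cm} \<inter> app H (insert (neg cm) (tops limit v)) \<noteq> {}"
      using limit_rejected[of v] v by simp
    then have "c \<in> app H (insert (neg cm) (tops limit v))"
      by (rule contradiction_from_cm) simp
    then have "{neg (neg cm)} \<subseteq> app H (tops limit v)" using neg_intro by blast
    then have "app H {cm} \<subseteq> app H (tops limit v)"
      using app_subset_closed[OF closure] double_neg by blast
    then show False using reflexive[of "{cm}"] limit_consistent[of v] by blast
  qed
  then have "neg cm \<in> tops limit (Suc v)" using v by (simp add: tops_Suc)
  then show ?thesis by blast
qed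

text \<open>Rejection passes from the tops below \<open>w\<close> to all tops by monotonicity, and
  \<open>neg cm\<close> among them turns a derived \<open>cm\<close> into \<open>c\<close>.\<close>

lemma all_tops_rejected:
  assumes "f w \<notin> all_tops"
  shows "c \<in> app H (insert (f w) all_tops)"
proof (rule contradiction_from_cm)
  have "\<not> (limit w \<noteq> [] \<and> last (limit w) = f w)" using assms all_topsI by metis
  then have "{c, cm} \<inter> app H (insert (f w) (tops limit w)) \<noteq> {}" by (rule limit_rejected)
  moreover have "app H (insert (f w) (tops limit w)) \<subseteq> app H (insert (f w) all_tops)"
    using tops_limit_subset by (intro app_mono) auto
  ultimately show "{c, cm} \<inter> app H (insert (f w) all_tops) \<noteq> {}" by blast
  show "neg cm \<in> insert (f w) all_tops" using neg_cm_in_limit tops_limit_subset by blast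
qed

text \<open>Consistency excludes having both sentences; one outside \<open>all_tops\<close> is
  refuted by \<open>all_tops\<close>, so its negation follows.\<close>

lemma completion_theses: "completion neg (app H all_tops)"
  unfolding completion_def
proof
  fix x
  have "\<not> {x, neg x} \<subseteq> app H all_tops"
    using app_subset_closed[OF closure, of "{x, neg x}" all_tops] neg_contradicts[of x]
      all_tops_consistent by blast
  moreover have "x \<in> app H all_tops \<or> neg x \<in> app H all_tops"
  proof (cases "x \<in> all_tops")
    case True
    then show ?thesis using reflexive by blast
  next
    case False
    then show ?thesis using all_tops_rejected neg_intro surj by (metis surjD)
  qed
  ultimately show "\<exists>!y. y \<in> app H all_tops \<inter> {x, neg x}" by auto
qed

end

section \<open>Good approximations and the end of revisions\<close>

locale good_run = bounded_run_with_negation +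
  assumes good_reflexive: "(\<forall>x\<in>X. x \<le> s) \<Longrightarrow> X \<subseteq> app (\<alpha> s) X"
    and good_transitive: "app (\<alpha> s) (app (\<alpha> s) X) \<subseteq> app (\<alpha> s) X"
begin

text \<open>Above the settled \<open>neg cm\<close>, whenever \<open>cm\<close> is derived the same
  finite operator also derives \<open>c\<close>, by goodness; discarding then takes precedence over
  revising.\<close>

lemma finitely_many_revisions:
  "\<exists>V. neg cm \<in> tops limit V \<and> (\<forall>u\<ge>V. limit u \<noteq> [] \<longrightarrow> last (limit u) = f u)"
proof -
  obtain v where v: "neg cm \<in> tops limit v" using neg_cm_in_limit by blast
  obtain t1 where t1: "\<And>s y. s \<ge> t1 \<Longrightarrow> y < v \<Longrightarrow> r s y = limit y" "\<And>s. s \<ge> t1 \<Longrightarrow> v \<le> m s"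
    using limit by blast
  obtain t2 where t2: "\<And>s. s \<ge> t2 \<Longrightarrow> c \<in> app (\<alpha> s) {cm, neg cm}"
    using app_stage[OF neg_contradicts[of cm]] by blast
  \<comment> \<open>From \<open>t\<close> on the stacks below \<open>v\<close> are settled,
    \<open>c\<close> is derived from \<open>{cm, neg cm}\<close>, and the stage bounds
    \<open>neg cm\<close>, as reflexivity of \<open>\<alpha> s\<close> requires.\<close>
  define t where "t = max (max t1 t2) (neg cm)"
  have no_revision: "c \<in> chi (\<alpha> s) (r s) z" if "s \<ge> t" "z \<ge> v" "cm \<in> chi (\<alpha> s) (r s) z" for s z
  proof -
    have "tops (r s) v = tops limit v" by (rule tops_cong) (use t1 that t_def in simp)
    then have "neg cm \<in> tops (r s) (Suc z)" using v tops_mono[of v "Suc z" "r s"] that(2) by auto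
    moreover have "{neg cm} \<subseteq> app (\<alpha> s) {neg cm}"
      using that(1) by (intro good_reflexive) (simp add: t_def)
    ultimately have "neg cm \<in> chi (\<alpha> s) (r s) z"
      unfolding chi_def using app_mono[OF order_refl, of "{neg cm}" "tops (r s) (z + 1)" "\<alpha> s"]
      by auto
    then have "app (\<alpha> s) {cm, neg cm} \<subseteq> app (\<alpha> s) (chi (\<alpha> s) (r s) z)"
      using that(3) by (intro app_mono) auto
    moreover have "app (\<alpha> s) (chi (\<alpha> s) (r s) z) \<subseteq> chi (\<alpha> s) (r s) z"
      unfolding chi_def by (rule good_transitive)
    moreover have "c \<in> app (\<alpha> s) {cm, neg cm}" using t2 that(1) by (simp add: t_def)
    ultimately show ?thesis by blast
  qed
  \<comment> \<open>Beyond \<open>m t\<close> all stacks are empty at stage \<open>t\<close>; beyond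
    \<open>v\<close>, any later revision would act strictly below \<open>u\<close> and leave the
    stack at \<open>u\<close> empty.\<close>
  define V where "V = Suc (max v (m t))"
  have unrevised: "r s u = [] \<or> r s u = [f u]" if "s \<ge> t" "u \<ge> V" for s u
    using that(1)
  proof (induction rule: dec_induct)
    case base
    then show ?case using run_invariant[of t] that(2) by (simp add: V_def)
  next
    case (step s)
    show ?case
    proof (cases rule: step_cases[of s])
      case extend
      then show ?thesis using step.IH by simp
    next
      case (discard z)
      then show ?thesis using step.IH by simp
    next
      case (revise z)
      then have "z < v" using no_revision[of s z] step(1) by (metis not_less)
      then have "z < u" using that(2) by (simp add: V_def)
      then show ?thesis using revise(7)[of u] by simp
    qed
  qed
  have "last (limit u) = f u" if "u \<ge> V" "limit u \<noteq> []" for u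
  proof -
    obtain t' where t': "\<And>s y. s \<ge> t' \<Longrightarrow> y < Suc u \<Longrightarrow> r s y = limit y"
        "\<And>s. s \<ge> t' \<Longrightarrow> Suc u \<le> m s"
      using limit by blast
    show ?thesis using unrevised[of "max t t'" u] t'(1)[of "max t t'" u] that by simp
  qed
  moreover have "neg cm \<in> tops limit V"
    using v tops_mono[of v V limit] unfolding V_def by (metis le_SucI max.cobounded1 subsetD)
  ultimately show ?thesis by blast
qed

text \<open>\<open>F\<close> collects the limit tops below \<open>V\<close>, among them
  \<open>neg cm\<close>. From \<open>V\<close> on the tops are the sentences \<open>f u\<close>
  themselves, so the tops below \<open>w\<close> lie in \<open>F\<close> or among the accepted
  sentences enumerated before \<open>w\<close>.\<close>

lemma early_refutation:
  "\<exists>F. finite F \<and> F \<subseteq> all_tops \<and> (\<forall>w. f w \<notin> all_tops \<longrightarrow>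
     c \<in> app H (insert (f w) (F \<union> {f u | u. u < w \<and> f u \<in> all_tops})))"
proof -
  obtain V where V: "neg cm \<in> tops limit V" "\<And>u. u \<ge> V \<Longrightarrow> limit u \<noteq> [] \<Longrightarrow> last (limit u) = f u"
    using finitely_many_revisions by blast
  have "c \<in> app H (insert (f w) (tops limit V \<union> {f u | u. u < w \<and> f u \<in> all_tops}))"
    (is "c \<in> app H ?X") if "f w \<notin> all_tops" for w
  proof (rule contradiction_from_cm)
    have "tops limit w \<subseteq> tops limit V \<union> {f u | u. u < w \<and> f u \<in> all_tops}"
    proof
      fix a assume "a \<in> tops limit w"
      then obtain u where u: "u < w" "limit u \<noteq> []" "a = last (limit u)"
        unfolding tops_def by blast
      then have "a \<in> all_tops" using all_topsI by blast
      then show "a \<in> tops limit V \<union> {f u | u. u < w \<and> f u \<in> all_tops}"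
        using u V(2)[of u] last_in_tops[of u V limit] by (cases "u < V") auto
    qed
    then have "app H (insert (f w) (tops limit w)) \<subseteq> app H ?X"
      by (intro app_mono) auto
    moreover have "{c, cm} \<inter> app H (insert (f w) (tops limit w)) \<noteq> {}"
      using all_topsI that by (intro limit_rejected) metis
    ultimately show "{c, cm} \<inter> app H ?X \<noteq> {}" by blast
  qed (use V(1) in simp)
  then show ?thesis
    by (intro exI[of _ "tops limit V"] conjI allI impI finite_tops tops_limit_subset)
qed

end

section \<open>Dialectical runs with prescribed theses\<close>

text \<open>Position by position the limit keeps exactly the members of \<open>B\<close>: a member
  is not refuted because \<open>B\<close> is consistent, and a nonmember is refuted by the members
  enumerated earlier.\<close>

lemma d_theses_greedy:
  assumes "computable_approximation \<beta> H" and closure: "closure_operator H"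
    and "c \<notin> app H {}" and "surj g"
    and B_consistent: "c \<notin> app H B"
    and refuted: "\<And>x. g x \<notin> B \<Longrightarrow> c \<in> app H (insert (g x) {g y | y. y < x \<and> g y \<in> B})"
  shows "d_theses \<beta> g c = app H B"
proof -
  \<comment> \<open>The run is read as a q-run with \<open>cm = c\<close>, where \<open>id\<close>
    fills the place of the revision function. Every stack is empty or holds just its own sentence,
    so the run is bounded and the limit theory applies.\<close>
  have no_revision: "length (snd (q_state \<beta> g id c c s) u) \<le> 1 \<and>
      (snd (q_state \<beta> g id c c s) u \<noteq> [] \<longrightarrow> last (snd (q_state \<beta> g id c c s) u) = g u)" for s u
  proof (induction s arbitrary: u)
    case 0
    then show ?case by (simp add: initial_def)
  next
    case (Suc s)
    obtain m r where state: "q_state \<beta> g id c c s = (m, r)" by fastforce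
    then have "length (r u) \<le> 1 \<and> (r u \<noteq> [] \<longrightarrow> last (r u) = g u)" for u
      using Suc[of u] unfolding state by simp
    then show ?case
      unfolding q_state.simps state d_step_conv_q_step[symmetric]
      by (auto simp: initial_def)
  qed
  interpret bounded_run \<beta> H g id c c
  proof
    show "\<beta> s \<subseteq> \<beta> (Suc s)" "(\<Union>s. \<beta> s) = H" for s
      using assms(1) unfolding computable_approximation_def by auto
    show "\<exists>B. \<forall>s. length (snd (q_state \<beta> g id c c s) u) \<le> B" for u
      using no_revision by blast
  qed fact+
  have last: "last (limit x) = g x" if "limit x \<noteq> []" for x
  proof -
    obtain t where t: "\<And>s y. s \<ge> t \<Longrightarrow> y < Suc x \<Longrightarrow> r s y = limit y" "\<And>s. s \<ge> t \<Longrightarrow> Suc x \<le> m s"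
      using limit by blast
    then show ?thesis using no_revision[of t x] that by simp
  qed
  have accepted: "limit x \<noteq> [] \<longleftrightarrow> g x \<in> B" for x
  proof (induction x rule: less_induct)
    case (less x)
    \<comment> \<open>By induction the tops below \<open>x\<close> are the earlier members of
      \<open>B\<close>, which is the set occurring in \<open>refuted\<close>.\<close>
    have tops: "tops limit x = {g y | y. y < x \<and> g y \<in> B}"
      unfolding tops_def using less last by (metis (lifting))
    show ?case
    proof
      assume "limit x \<noteq> []"
      then have "c \<notin> app H (insert (g x) {g y | y. y < x \<and> g y \<in> B})"
        using limit_consistent[of "Suc x"] last by (simp add: tops_Suc tops)
      then show "g x \<in> B" using refuted by blast
    next
      assume "g x \<in> B"
      then have "app H (insert (g x) (tops limit x)) \<subseteq> app H B"
        unfolding tops by (intro app_mono) auto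
      then show "limit x \<noteq> []" using limit_rejected[of x] B_consistent by auto
    qed
  qed
  have "all_tops = B"
  proof
    show "all_tops \<subseteq> B"
      unfolding all_tops_def tops_def using accepted last by auto
    show "B \<subseteq> all_tops"
    proof
      fix b assume "b \<in> B"
      then obtain x where "b = g x" using \<open>surj g\<close> by (metis surjD)
      then show "b \<in> all_tops" using all_topsI[of x] accepted last \<open>b \<in> B\<close> by simp
    qed
  qed
  moreover have "d_theses \<beta> g c = q_theses \<beta> g id c c"
    unfolding d_theses_def q_theses_def
    using ext[of "d_state \<beta> g c", OF d_state_conv_q_state] by simp
  ultimately show ?thesis using theses_eq by simp
qed

section \<open>The dialectical system with the rearranged enumeration\<close>

theorem theorem4p6:
  fixes H :: "nat set" and f fm :: "nat \<Rightarrow> nat" and c cm :: nat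
    and neg :: "nat \<Rightarrow> nat" and imp con dis :: "nat \<Rightarrow> nat \<Rightarrow> nat"
    and \<alpha> :: "nat \<Rightarrow> nat set"
  assumes "q_dialectical_system H f fm c cm"
    and "q_consistent H c cm"
    and "connectives H c neg imp con dis"
    and "good_approximation \<alpha> H"
    and "loopless \<alpha> f fm c cm"
  shows "\<exists>H' f' c' neg' imp' con' dis'.
           dialectical_system H' f' c' \<and>
           connectives H' c' neg' imp' con' dis' \<and>
           represents H' f' c' (q_theses \<alpha> f fm c cm) \<and>
           completion neg' (q_theses \<alpha> f fm c cm)"
proof -
  have H: "enumeration_operator H" "closure_operator H" "app H {} \<noteq> {}" "app H {c} = UNIV"
      "computable1 f" "bij f" "acyclic_fun fm"
    using assms(1) unfolding q_dialectical_system_def dialectical_system_def by auto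
  have consistent: "c \<notin> app H {}" "cm \<notin> app H {}"
    using assms(2) unfolding q_consistent_def by auto
  have approx: "computable_approximation \<alpha> H"
    using assms(4) unfolding good_approximation_def by blast
  interpret q_run \<alpha> H f fm c cm
  proof
    show "\<alpha> s \<subseteq> \<alpha> (Suc s)" "(\<Union>s. \<alpha> s) = H" for s
      using approx unfolding computable_approximation_def by auto
  qed (use H consistent bij_is_surj in blast)+
  interpret good_run \<alpha> H f fm c cm neg
  proof
    show "\<exists>B. \<forall>s. length (snd (q_state \<alpha> f fm c cm s) u) \<le> B" for u
      using assms(5) H(7) by (rule loopless_bounded)
    show "X \<subseteq> app (\<alpha> s) X" if "\<forall>x\<in>X. x \<le> s" for X s
      using assms(4) that unfolding good_approximation_def by blast
    show "app (\<alpha> s) (app (\<alpha> s) X) \<subseteq> app (\<alpha> s) X" for X s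
      using assms(4) unfolding good_approximation_def by blast
    show "c \<in> app H {x, neg x}" "app H {neg (neg x)} = app H {x}" for x
      using assms(3) unfolding connectives_def by blast+
    show "neg x \<in> app H X" if "c \<in> app H (insert x X)" for x X
      using assms(3) that unfolding connectives_def by simp
  qed
  obtain F where F: "finite F" "F \<subseteq> all_tops"
      "\<And>w. f w \<notin> all_tops \<Longrightarrow>
        c \<in> app H (insert (f w) (F \<union> {f u | u. u < w \<and> f u \<in> all_tops}))"
    using early_refutation by blast
  obtain g k where g: "bij g" "\<And>i. i > k \<Longrightarrow> g i = f i"
      "\<And>x y. x \<in> F \<Longrightarrow> y \<notin> F \<Longrightarrow> inv g x < inv g y"
      "\<And>x y. x \<notin> F \<Longrightarrow> y \<notin> F \<Longrightarrow> inv f x < inv f y \<Longrightarrow> inv g x < inv g y"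
    using move_finite_set_to_front[OF F(1) H(6)] by blast
  have inv_f: "inv f (f u) = u" for u
    using H(6) by (simp add: bij_is_inj)
  have inv_g: "inv g (g x) = x" "g (inv g a) = a" for x a
    using g(1) by (simp_all add: bij_is_inj bij_is_surj surj_f_inv_f)
  have refuted: "c \<in> app H (insert (g x) {g y | y. y < x \<and> g y \<in> all_tops})"
    if x: "g x \<notin> all_tops" for x
  proof -
    define w where "w = inv f (g x)"
    have w: "f w = g x" using H(6) unfolding w_def by (simp add: bij_is_surj surj_f_inv_f)
    \<comment> \<open>Members of \<open>F\<close> come before \<open>g x\<close> because
      \<open>g x\<close> lies outside \<open>F\<close>; the other accepted sentences keep their
      \<open>f\<close>-order relative to \<open>g x\<close>.\<close>
    have "F \<union> {f u | u. u < w \<and> f u \<in> all_tops} \<subseteq> {g y | y. y < x \<and> g y \<in> all_tops}"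
    proof
      fix a assume a: "a \<in> F \<union> {f u | u. u < w \<and> f u \<in> all_tops}"
      then have "a \<in> all_tops" using F(2) by blast
      moreover have "inv g a < inv g (g x)"
      proof (cases "a \<in> F")
        case True
        then show ?thesis using g(3) x F(2) by blast
      next
        case False
        then have "inv f a < inv f (g x)" using a inv_f w_def by auto
        then show ?thesis using False x F(2) by (intro g(4)) auto
      qed
      ultimately show "a \<in> {g y | y. y < x \<and> g y \<in> all_tops}"
        using inv_g by (metis (mono_tags, lifting) mem_Collect_eq)
    qed
    then have "app H (insert (g x) (F \<union> {f u | u. u < w \<and> f u \<in> all_tops})) \<subseteq>
        app H (insert (g x) {g y | y. y < x \<and> g y \<in> all_tops})"
      by (intro app_mono) auto
    then show ?thesis using F(3)[of w] w x by auto
  qed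
  \<comment> \<open>The argument is uniform in \<open>\<beta>\<close>, as \<open>represents\<close>
    quantifies over all approximations, good or not.\<close>
  have "d_theses \<beta> g c = app H all_tops" if "computable_approximation \<beta> H" for \<beta>
    using that H(2) consistent(1) bij_is_surj[OF g(1)] all_tops_consistent(1) refuted
    by (rule d_theses_greedy)
  then have "represents H g c (q_theses \<alpha> f fm c cm)"
    unfolding represents_def theses_eq using approx by blast
  \<comment> \<open>\<open>g\<close> agrees with \<open>f\<close> strictly above \<open>k\<close>,
    hence the bound \<open>Suc k\<close>.\<close>
  moreover have "computable1 g"
    using H(5) g(2) by (rule computable1_finite_modification[where k = "Suc k"]) simp
  ultimately show ?thesis
    using H g(1) assms(3) completion_theses
    unfolding dialectical_system_def theses_eq by blast
qed

end
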